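(* Let $\mathbb{F}\in\{\mathbb{R},\mathbb{C}\}$ and let $A=\operatorname{DPR1}(\Delta,x,y,\rho)\in\mathbb{F}^{n\times n}$ be a diagonal-plus-rank-one matrix. If all $\delta_i\neq 0$, $i=1,\dots,n$, then $$ \det(A)=\Big(\prod_i\delta_i\Big)\,(1+y^\star\Delta^{-1}x\rho). $$ If $\delta_i=0$ for some $i\in\{1,\dots,n\}$, then $$ \det(A)=\Big(\prod_{j=1}^{i-1}\delta_j\Big)\,y_i^\star\,\Big(\prod_{j=i+1}^{n}\delta_j\Big)\,x_i\,\rho . $$
   Context: $\star$ denotes the transpose of a real matrix or vector, the conjugate transpose of a complex matrix or vector, and the conjugate of a scalar. Diagonal-plus-rank-one matrix: $\operatorname{DPR1}(\Delta,x,y,\rho)=\Delta+x\rho y^\star$, where $\Delta\in\mathbb{F}^{n\times n}$ is diagonal with diagonal elements $\delta_1,\dots,\delta_n$, $x,y\in\mathbb{F}^n$ and $\rho\in\mathbb{F}$. Empty products equal $1$. *)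

theory Defs
  imports
    "Jordan_Normal_Form.Determinant"
    "Jordan_Normal_Form.Gauss_Jordan_Elimination"
    "Jordan_Normal_Form.Conjugate"
begin

text \<open>The overloaded \<^const>\<open>conjugate\<close> plays the role of the star operation: it is the identity on
  \<^typ>\<open>real\<close>, complex conjugation on \<^typ>\<open>complex\<close>, and acts entrywise on vectors.  The
  \<open>(i,j)\<close> entry of the outer product \<open>x \<rho> y\<^sup>\<star>\<close> is therefore
  \<open>x\<^sub>i \<rho> y\<^sub>j\<^sup>\<star>\<close>.\<close>

definition DPR1 ::
  "'a :: conjugatable_field mat \<Rightarrow> 'a vec \<Rightarrow> 'a vec \<Rightarrow> 'a \<Rightarrow> 'a mat" where
  "DPR1 \<Delta> x y \<rho> =
     \<Delta> + mat (dim_vec x) (dim_vec y) (\<lambda>(i, j). x $ i * \<rho> * conjugate (y $ j))"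

text \<open>\<^const>\<open>mat_inverse\<close> returns an option; \<open>mat_inv A\<close> is the inverse of \<open>A\<close> whenever
  \<open>A\<close> is invertible, and is unspecified otherwise.\<close>

definition mat_inv :: "'a :: field mat \<Rightarrow> 'a mat" where
  "mat_inv A = the (mat_inverse A)"

end

theory Submission
  imports Defs
begin

text \<open>In both cases the matrix splits into two factors whose determinants can be read off. If
  \<delta>_i = 0, row i of the matrix is x_i \<rho> y*, and the matrix is E F, where E is the
  identity apart from column i and F is \<Delta> apart from row i. Each of these is diagonal up to
  one row or column, so its determinant is the product of its diagonal
  (\<open>det_diagonal_outside_row\<close>). The missing \<delta>_i is thereby replaced by the entry
  of y* from F and the factor x_i \<rho> from E.\<close>

text \<open>A permutation cannot move exactly one point, so every non-identity term of the Leibniz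
  sum contains an off-diagonal factor from a row other than \<open>i\<close>. Only the identity term
  survives.\<close>

lemma det_diagonal_outside_row:
  assumes A: "A \<in> carrier_mat n n"
    and off: "\<And>k l. k < n \<Longrightarrow> l < n \<Longrightarrow> k \<noteq> i \<Longrightarrow> k \<noteq> l \<Longrightarrow> A $$ (k, l) = 0"
  shows "det A = (\<Prod>k<n. A $$ (k, k))"
proof -
  have "signof p * (\<Prod>k = 0..<n. A $$ (k, p k)) = 0"
    if p: "p permutes {0..<n}" "p \<noteq> id" for p
  proof -
    obtain k where k: "k \<noteq> i" "p k \<noteq> k"
    proof (rule ccontr)
      assume "\<not> thesis"
      with that have fix_other: "\<And>k. k \<noteq> i \<Longrightarrow> p k = k" by blast
      \<comment> \<open>If \<open>p i\<close> differed from \<open>i\<close>, it would be fixed by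
        \<open>p\<close>, and injectivity applied to \<open>p (p i) = p i\<close> gives
        \<open>p i = i\<close> after all.\<close>
      moreover have "p i = i"
        using fix_other[of "p i"] permutes_inj[OF p(1)] by (metis injD)
      ultimately have "p = id" by (metis eq_id_iff)
      with p(2) show False by contradiction
    qed
    have "k \<in> {0..<n}" using k(2) p(1) by (meson permutes_not_in)
    moreover from this have "p k \<in> {0..<n}" using p(1) by (simp add: permutes_in_image)
    ultimately have "(\<Prod>k = 0..<n. A $$ (k, p k)) = 0"
      using k off[of k "p k"] by (intro prod_zero) auto
    then show ?thesis by simp
  qed
  then have "det A = (\<Sum>p\<in>{id}. signof p * (\<Prod>k = 0..<n. A $$ (k, p k)))"
    unfolding det_def'[OF A]
    by (intro sum.mono_neutral_right) (auto simp: finite_permutations permutes_id)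
  then show ?thesis by (simp add: atLeast0LessThan)
qed

text \<open>This is the column-times-row case of Sylvester's identity det (I - C R) = det (I - R C),
  whose right-hand side is here a 1 by 1 determinant.\<close>

lemma det_one_plus_rank_one:
  fixes w v :: "'a :: idom vec"
  assumes w: "w \<in> carrier_vec n" and v: "v \<in> carrier_vec n"
  shows "det (1\<^sub>m n + mat n n (\<lambda>(i, j). w $ i * v $ j)) = 1 + v \<bullet> w"
proof -
  define C where "C = mat n 1 (\<lambda>(i, _). w $ i)"
  \<comment> \<open>The sign turns I - C R into the required I + w v^T.\<close>
  define R where "R = mat 1 n (\<lambda>(_, j). - v $ j)"
  have C: "C \<in> carrier_mat n 1" and R: "R \<in> carrier_mat 1 n"
    by (auto simp: C_def R_def)
  have CR: "1\<^sub>m n - C * R = 1\<^sub>m n + mat n n (\<lambda>(i, j). w $ i * v $ j)"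
    by (intro eq_matI) (auto simp: C_def R_def scalar_prod_def)
  have RC: "1\<^sub>m 1 - R * C = mat 1 1 (\<lambda>_. 1 + v \<bullet> w)"
    using w v by (intro eq_matI) (auto simp: C_def R_def scalar_prod_def sum_negf)
  \<comment> \<open>Eliminating either diagonal block of the bordered matrix \<open>M\<close> gives
    \<open>M = L * U\<close> and \<open>M = V * L\<close>, with the two Schur complements inside
    \<open>U\<close> and \<open>V\<close>. Since \<open>L\<close> is unitriangular, its determinant
    is 1 and cancels.\<close>
  define M where "M = four_block_mat (1\<^sub>m 1) R C (1\<^sub>m n)"
  define L where "L = four_block_mat (1\<^sub>m 1) (0\<^sub>m 1 n) C (1\<^sub>m n)"
  define U where "U = four_block_mat (1\<^sub>m 1) R (0\<^sub>m n 1) (1\<^sub>m n - C * R)"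
  define V where "V = four_block_mat (1\<^sub>m 1 - R * C) R (0\<^sub>m n 1) (1\<^sub>m n)"
  have carr: "L \<in> carrier_mat (1 + n) (1 + n)" "U \<in> carrier_mat (1 + n) (1 + n)"
    "V \<in> carrier_mat (1 + n) (1 + n)"
    using C R by (auto simp: L_def U_def V_def)
  have "M = L * U"
    unfolding M_def L_def U_def
    using C R by (subst mult_four_block_mat[where ?nr1.0 = 1 and ?n1.0 = 1 and ?nr2.0 = n and
        ?n2.0 = n and ?nc1.0 = 1 and ?nc2.0 = n]) (auto simp: comm_add_mat)
  moreover have "M = V * L"
    unfolding M_def L_def V_def
    using C R by (subst mult_four_block_mat[where ?nr1.0 = 1 and ?n1.0 = 1 and ?nr2.0 = n and
        ?n2.0 = n and ?nc1.0 = 1 and ?nc2.0 = n]) auto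
  ultimately have "det L * det U = det V * det L"
    using det_mult[OF carr(1,2)] det_mult[OF carr(3,1)] by simp
  moreover have "det L = det (1\<^sub>m 1 :: 'a mat) * det (1\<^sub>m n :: 'a mat)"
    unfolding L_def using C by (intro det_four_block_mat_upper_right_zero) auto
  moreover have "det U = det (1\<^sub>m 1 :: 'a mat) * det (1\<^sub>m n - C * R)"
    unfolding U_def using C R by (intro det_four_block_mat_lower_left_zero) auto
  moreover have "det V = det (1\<^sub>m 1 - R * C) * det (1\<^sub>m n :: 'a mat)"
    unfolding V_def using C R by (intro det_four_block_mat_lower_left_zero) auto
  ultimately have "det (1\<^sub>m n - C * R) = det (1\<^sub>m 1 - R * C)"
    by (simp del: One_nat_def)
  then show ?thesis unfolding CR RC by (simp add: det_single)
qed

text \<open>A nonzero determinant makes \<open>A\<close> a unit of the matrix ring, which rules out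
  \<open>None\<close> as the value of \<open>mat_inverse\<close>; so \<open>the\<close> yields a
  genuine inverse.\<close>

lemma mat_inv_diagonal:
  assumes A: "A \<in> carrier_mat n n" "diagonal_mat A"
    and nz: "\<forall>i<n. A $$ (i, i) \<noteq> 0"
  shows "mat_inv A \<in> carrier_mat n n" "A * mat_inv A = 1\<^sub>m n"
proof -
  have "det A = (\<Prod>k<n. A $$ (k, k))"
    using A by (intro det_diagonal_outside_row[where i = 0]) (auto simp: diagonal_mat_def)
  also have "\<dots> \<noteq> 0" using nz by auto
  finally have "A \<in> Units (ring_mat TYPE('a) n ())"
    by (rule det_non_zero_imp_unit[OF A(1)])
  then obtain B where "mat_inverse A = Some B"
    using mat_inverse(1)[OF A(1)] by fastforce
  with mat_inverse(2)[OF A(1)]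
  show "mat_inv A \<in> carrier_mat n n" "A * mat_inv A = 1\<^sub>m n"
    by (auto simp: mat_inv_def)
qed

lemma diagonal_mult_vec_index:
  fixes D :: "'a :: semiring_0 mat"
  assumes D: "D \<in> carrier_mat n n" "diagonal_mat D" and v: "v \<in> carrier_vec n" and "i < n"
  shows "(D *\<^sub>v v) $ i = D $$ (i, i) * v $ i"
proof -
  have "(D *\<^sub>v v) $ i = (\<Sum>k<n. D $$ (i, k) * v $ k)"
    using assms by (simp add: scalar_prod_def atLeast0LessThan)
  also have "\<dots> = (\<Sum>k<n. if k = i then D $$ (i, i) * v $ i else 0)"
    using assms by (intro sum.cong) (auto simp: diagonal_mat_def)
  finally show ?thesis using \<open>i < n\<close> by simp
qed

lemma det_DPR1_nonzero:
  fixes \<Delta> :: "'a :: conjugatable_field mat"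
  assumes \<Delta>: "\<Delta> \<in> carrier_mat n n" "diagonal_mat \<Delta>"
    and x: "x \<in> carrier_vec n" and y: "y \<in> carrier_vec n"
    and nz: "\<forall>i<n. \<Delta> $$ (i, i) \<noteq> 0"
  shows "det (DPR1 \<Delta> x y \<rho>) =
    (\<Prod>i<n. \<Delta> $$ (i, i)) * (1 + (conjugate y \<bullet> (mat_inv \<Delta> *\<^sub>v x)) * \<rho>)"
proof -
  note inv = mat_inv_diagonal[OF \<Delta> nz]
  define w where "w = mat_inv \<Delta> *\<^sub>v x"
  have w: "w \<in> carrier_vec n" using inv x by (simp add: w_def)
  have "\<Delta> *\<^sub>v w = x"
    using inv x \<Delta> by (simp add: w_def flip: assoc_mult_mat_vec)
  \<comment> \<open>Reading \<Delta> w = x row by row lets the factorization be checked entrywise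
    without computing the entries of the inverse.\<close>
  then have xw: "x $ i = \<Delta> $$ (i, i) * w $ i" if "i < n" for i
    using diagonal_mult_vec_index[OF \<Delta> w that] by simp
  let ?B = "1\<^sub>m n + mat n n (\<lambda>(i, j). (\<rho> \<cdot>\<^sub>v w) $ i * conjugate y $ j)"
  have "DPR1 \<Delta> x y \<rho> = \<Delta> * ?B"
  proof (intro eq_matI)
    fix i j assume "i < dim_row (\<Delta> * ?B)" "j < dim_col (\<Delta> * ?B)"
    then have ij: "i < n" "j < n" using \<Delta> by auto
    have "(\<Delta> * ?B) $$ (i, j) = \<Delta> $$ (i, i) * ?B $$ (i, j)"
      using ij \<Delta> diagonal_mult_vec_index[OF \<Delta>, of "col ?B j" i] by simp
    also have "\<dots> = DPR1 \<Delta> x y \<rho> $$ (i, j)"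
      using ij \<Delta> x y w by (auto simp: DPR1_def xw diagonal_mat_def algebra_simps)
    finally show "DPR1 \<Delta> x y \<rho> $$ (i, j) = (\<Delta> * ?B) $$ (i, j)" by simp
  qed (use \<Delta> x y in \<open>auto simp: DPR1_def\<close>)
  moreover have "det (\<Delta> * ?B) = det \<Delta> * det ?B"
    using \<Delta> by (intro det_mult) auto
  moreover have "det \<Delta> = (\<Prod>i<n. \<Delta> $$ (i, i))"
    using \<Delta> by (intro det_diagonal_outside_row[where i = 0]) (auto simp: diagonal_mat_def)
  moreover have "det ?B = 1 + conjugate y \<bullet> (\<rho> \<cdot>\<^sub>v w)"
    using w y by (intro det_one_plus_rank_one) auto
  moreover have "conjugate y \<bullet> (\<rho> \<cdot>\<^sub>v w) = (conjugate y \<bullet> w) * \<rho>"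
    using w y by (simp add: mult.commute)
  ultimately show ?thesis by (simp add: w_def)
qed

text \<open>When \<open>\<delta>\<^sub>i = 0\<close>, the matrix factors as the identity with column \<open>i\<close> replaced by
  \<open>x \<rho>\<close>, times \<open>\<Delta>\<close> with row \<open>i\<close> replaced by \<open>y\<^sup>\<star>\<close>.\<close>

lemma det_DPR1_zero:
  fixes \<Delta> :: "'a :: conjugatable_field mat"
  assumes \<Delta>: "\<Delta> \<in> carrier_mat n n" "diagonal_mat \<Delta>"
    and x: "x \<in> carrier_vec n" and y: "y \<in> carrier_vec n"
    and i: "i < n" "\<Delta> $$ (i, i) = 0"
  shows "det (DPR1 \<Delta> x y \<rho>) =
    (\<Prod>j<i. \<Delta> $$ (j, j)) * conjugate (y $ i) * (\<Prod>j\<in>{i<..<n}. \<Delta> $$ (j, j)) * x $ i * \<rho>"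
proof -
  define E where "E = mat n n (\<lambda>(k, l). if l = i then x $ k * \<rho> else if k = l then 1 else 0)"
  define F where "F = mat n n (\<lambda>(k, l). if k = i then conjugate (y $ l) else \<Delta> $$ (k, l))"
  have E: "E \<in> carrier_mat n n" and F: "F \<in> carrier_mat n n" by (auto simp: E_def F_def)
  have split: "{..<n} = {..<i} \<union> {i} \<union> {i<..<n}" using i by auto
  have prod_split: "(\<Prod>k<n. f k) = (\<Prod>k<i. f k) * f i * (\<Prod>k\<in>{i<..<n}. f k)" for f :: "nat \<Rightarrow> 'a"
    unfolding split by (subst prod.union_disjoint; (subst prod.union_disjoint)?) auto
  have "DPR1 \<Delta> x y \<rho> = E * F"
  proof (intro eq_matI)
    fix k l assume "k < dim_row (E * F)" "l < dim_col (E * F)"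
    then have kl: "k < n" "l < n" using E F by auto
    have "(E * F) $$ (k, l) = (\<Sum>m<n. E $$ (k, m) * F $$ (m, l))"
      using kl E F by (simp add: scalar_prod_def atLeast0LessThan)
    \<comment> \<open>The summand m = i gives the rank-one entry, and m = k gives the entry of
      \<Delta>. For k = i these coincide, and the extra term \<open>\<Delta> $$ (i, l)\<close>
      vanishes: by diagonality if l differs from i, by \<delta>_i = 0 if l = i.\<close>
    also have "\<dots> = (\<Sum>m<n. (if m = i then x $ k * \<rho> * conjugate (y $ l) else 0) +
        (if m = k then \<Delta> $$ (k, l) else 0))"
      using kl i \<Delta> by (intro sum.cong) (auto simp: E_def F_def diagonal_mat_def)
    also have "\<dots> = DPR1 \<Delta> x y \<rho> $$ (k, l)"
      using kl i \<Delta> x y by (simp add: sum.distrib DPR1_def)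
    finally show "DPR1 \<Delta> x y \<rho> $$ (k, l) = (E * F) $$ (k, l)" by simp
  qed (use \<Delta> x y E F in \<open>auto simp: DPR1_def\<close>)
  then have "det (DPR1 \<Delta> x y \<rho>) = det E * det F" using det_mult[OF E F] by simp
  moreover have "det E = x $ i * \<rho>"
  proof -
    \<comment> \<open>Transposing turns the exceptional column of \<open>E\<close> into an
      exceptional row.\<close>
    have "det E = det (transpose_mat E)" using det_transpose[OF E] by simp
    also have "\<dots> = (\<Prod>k<n. transpose_mat E $$ (k, k))"
      by (intro det_diagonal_outside_row[where i = i]) (auto simp: E_def)
    also have "\<dots> = (\<Prod>k<n. if k = i then x $ i * \<rho> else 1)"
      by (intro prod.cong) (auto simp: E_def)
    finally show ?thesis using i by simp
  qed
  moreover have "det F = (\<Prod>j<i. \<Delta> $$ (j, j)) * conjugate (y $ i) * (\<Prod>j\<in>{i<..<n}. \<Delta> $$ (j, j))"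
  proof -
    have "det F = (\<Prod>k<n. F $$ (k, k))"
      using \<Delta> by (intro det_diagonal_outside_row[where i = i]) (auto simp: F_def diagonal_mat_def)
    also have "\<dots> = (\<Prod>j<i. \<Delta> $$ (j, j)) * conjugate (y $ i) * (\<Prod>j\<in>{i<..<n}. \<Delta> $$ (j, j))"
      unfolding prod_split using i by (auto simp: F_def)
    finally show ?thesis .
  qed
  ultimately show ?thesis by (simp add: mult_ac)
qed

theorem lemma3:
  fixes n :: nat
  shows
    "(\<forall>(\<Delta> :: real mat) (x :: real vec) (y :: real vec) (\<rho> :: real).
        \<Delta> \<in> carrier_mat n n \<and> diagonal_mat \<Delta> \<and> x \<in> carrier_vec n \<and> y \<in> carrier_vec n \<longrightarrow>
          ((\<forall>i<n. \<Delta> $$ (i, i) \<noteq> 0) \<longrightarrow>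
             det (DPR1 \<Delta> x y \<rho>) =
               (\<Prod>i<n. \<Delta> $$ (i, i)) * (1 + (conjugate y \<bullet> (mat_inv \<Delta> *\<^sub>v x)) * \<rho>)) \<and>
          (\<forall>i<n. \<Delta> $$ (i, i) = 0 \<longrightarrow>
             det (DPR1 \<Delta> x y \<rho>) =
               (\<Prod>j<i. \<Delta> $$ (j, j)) * conjugate (y $ i) *
               (\<Prod>j\<in>{i<..<n}. \<Delta> $$ (j, j)) * x $ i * \<rho>)) \<and>
     (\<forall>(\<Delta> :: complex mat) (x :: complex vec) (y :: complex vec) (\<rho> :: complex).
        \<Delta> \<in> carrier_mat n n \<and> diagonal_mat \<Delta> \<and> x \<in> carrier_vec n \<and> y \<in> carrier_vec n \<longrightarrow>
          ((\<forall>i<n. \<Delta> $$ (i, i) \<noteq> 0) \<longrightarrow>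
             det (DPR1 \<Delta> x y \<rho>) =
               (\<Prod>i<n. \<Delta> $$ (i, i)) * (1 + (conjugate y \<bullet> (mat_inv \<Delta> *\<^sub>v x)) * \<rho>)) \<and>
          (\<forall>i<n. \<Delta> $$ (i, i) = 0 \<longrightarrow>
             det (DPR1 \<Delta> x y \<rho>) =
               (\<Prod>j<i. \<Delta> $$ (j, j)) * conjugate (y $ i) *
               (\<Prod>j\<in>{i<..<n}. \<Delta> $$ (j, j)) * x $ i * \<rho>))"
  \<comment> \<open>Both fields are instances of \<open>conjugatable_field\<close>, over which the
    two cases were proved.\<close>
  by (intro conjI allI impI; elim conjE; (rule det_DPR1_nonzero | rule det_DPR1_zero); assumption)

end
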